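(* Let $\mathbb K$ be a field. Every eventually linearly recursive sequence $\mathcal P=(P_n)_{n\in\mathbb N}$ of polynomials in $\mathbb K[x]$ is recursively well-adjusted: for every eventually linearly recursive sequence $\mathbf a=(a_n)_{n\in\mathbb N}$ in $\mathbb K$, the sequence $\mathcal P\triangleright\mathbf a=(P_n\triangleright\mathbf a)_{n\in\mathbb N}$ is eventually linearly recursive.
   Context: $\mathbb N=\mathbb Z_{\ge0}$. For a polynomial $P(x)=\sum_kc_kx^k$ and a sequence $\mathbf a=(a_n)_n$, $P\triangleright\mathbf a:=\sum_kc_ka_k$. A sequence $(b_n)_{n\in\mathbb N}$ in a commutative ring $R$ is eventually linearly recursive if there are $T\ge1$ and $c_0,\dots,c_{T-1}\in R$ with $b_{n+T}=c_{T-1}b_{n+T-1}+\cdots+c_0b_n$ for all sufficiently large $n$. For a sequence of polynomials one takes $R=\mathbb K[x]$ (so the $c_i$ are polynomials); for a sequence of scalars one takes $R=\mathbb K$. *)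

theory Defs
  imports "HOL-Computational_Algebra.Polynomial"
begin

definition eventually_linearly_recursive :: "(nat \<Rightarrow> 'a::comm_ring_1) \<Rightarrow> bool" where
  "eventually_linearly_recursive b \<longleftrightarrow>
     (\<exists>T\<ge>1. \<exists>c :: nat \<Rightarrow> 'a. \<forall>\<^sub>F n in sequentially. b (n + T) = (\<Sum>i<T. c i * b (n + i)))"

definition poly_pairing :: "'a::comm_ring_1 poly \<Rightarrow> (nat \<Rightarrow> 'a) \<Rightarrow> 'a" (infix \<open>\<triangleright>\<close> 70) where
  "P \<triangleright> a = (\<Sum>k\<le>degree P. coeff P k * a k)"

definition recursively_well_adjusted :: "(nat \<Rightarrow> 'a::comm_ring_1 poly) \<Rightarrow> bool" where
  "recursively_well_adjusted P \<longleftrightarrow>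
     (\<forall>a. eventually_linearly_recursive a \<longrightarrow> eventually_linearly_recursive (\<lambda>n. P n \<triangleright> a))"

end

theory Submission
  imports Defs "HOL-Library.Function_Algebras"
begin

text \<open>
  Pairing with a fixed sequence \<open>a\<close> is a linear functional on \<open>K[x]\<close>. If \<open>a\<close> satisfies
  a recursion from some index on, this functional vanishes on the ideal generated by a nonzero
  polynomial \<open>M\<close>, namely the characteristic polynomial of the recursion times a power of \<open>x\<close>
  that skips the initial terms (\<open>poly_pairing_annihilator\<close>). Hence it only sees the
  finite-dimensional algebra \<open>K[x]/(M)\<close>.

  Drop the initial terms of \<open>P\<close>, so that its recursion, of order \<open>L\<close> with coefficients
  in \<open>K[x]\<close>, holds everywhere. Then every shift of \<open>P\<close> is a \<open>K[x]\<close>-combination of the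
  first \<open>L\<close> shifts, with multipliers that do not depend on the index. After reduction of
  these multipliers modulo \<open>M\<close>, finitely many scalar sequences
  \<open>n \<mapsto> x\<^sup>j P\<^bsub>n+i\<^esub> \<triangleright> a\<close>, with \<open>j \<le> degree M\<close> and \<open>i < L\<close>, therefore span all
  shifts of \<open>n \<mapsto> P\<^sub>n \<triangleright> a\<close> (\<open>module_shifts_in_span\<close>).

  Over a field, a sequence whose shifts lie in a finite-dimensional space is linearly recursive,
  because some shift is a combination of the earlier ones
  (\<open>eventually_linearly_recursive_if_shifts_finite_dim\<close>).
\<close>

section \<open>Recursive sequences and finite-dimensional spaces of shifts\<close>

interpretation seq: vector_space "\<lambda>(c::'k::field) (f::nat \<Rightarrow> 'k) n. c * f n"
  by unfold_locales (auto simp: fun_eq_iff algebra_simps)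

lemma eventually_linearly_recursive_shiftD:
  assumes "eventually_linearly_recursive (\<lambda>n. b (n + N))"
  shows "eventually_linearly_recursive b"
proof -
  from assms obtain T c where T: "T \<ge> 1"
    and ev: "\<forall>\<^sub>F n in sequentially. b (n + T + N) = (\<Sum>i<T. c i * b (n + i + N))"
    unfolding eventually_linearly_recursive_def by blast
  have "\<forall>\<^sub>F n in sequentially. b ((n + N) + T) = (\<Sum>i<T. c i * b ((n + N) + i))"
    using ev by (simp add: ac_simps)
  then have "\<forall>\<^sub>F n in sequentially. b (n + T) = (\<Sum>i<T. c i * b (n + i))"
    by (rule eventually_sequentially_seg[THEN iffD1])
  then show ?thesis using T unfolding eventually_linearly_recursive_def by blast
qed

lemma sum_fun_apply:
  fixes f :: "'a \<Rightarrow> 'b \<Rightarrow> 'c::comm_monoid_add"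
  shows "(\<Sum>i\<in>A. f i) x = (\<Sum>i\<in>A. f i x)"
  by (induction A rule: infinite_finite_induct) auto

text \<open>
  The family \<open>g\<close> may have repetitions, so the coefficients are indexed by position rather
  than by vector.
\<close>
lemma seq_span_image_lessThan:
  fixes g :: "nat \<Rightarrow> nat \<Rightarrow> 'k::field"
  assumes "f \<in> seq.span (g ` {..<m})"
  shows "\<exists>c. \<forall>n. f n = (\<Sum>i<m. c i * g i n)"
  using assms
proof (induction m arbitrary: f)
  case 0
  then show ?case by simp
next
  case (Suc m)
  then obtain k where "f - (\<lambda>n. k * g m n) \<in> seq.span (g ` {..<m})"
    by (auto simp: lessThan_Suc seq.span_breakdown_eq)
  from Suc.IH[OF this] obtain c where c: "\<And>n. f n - k * g m n = (\<Sum>i<m. c i * g i n)"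
    by auto
  have "f n = (\<Sum>i<Suc m. (c(m := k)) i * g i n)" for n
    using c[of n] by (simp add: diff_eq_eq)
  then show ?case by blast
qed

text \<open>
  If no shift were a combination of the earlier ones, any number of shifts would be linearly
  independent, which the dimension bound forbids.
\<close>
lemma eventually_linearly_recursive_if_shifts_finite_dim:
  fixes f :: "nat \<Rightarrow> 'k::field"
  assumes fin: "finite B" and sp: "\<And>i. (\<lambda>n. f (n + i)) \<in> seq.span B"
  shows "eventually_linearly_recursive f"
proof -
  let ?g = "\<lambda>i n. f (n + i)"
  have "\<exists>m. ?g m \<in> seq.span (?g ` {..<m})"
  proof (rule ccontr)
    assume "\<not> ?thesis"
    then have new: "?g m \<notin> seq.span (?g ` {..<m})" for m by blast
    have "seq.independent (?g ` {..<m}) \<and> card (?g ` {..<m}) = m" for m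
    proof (induction m)
      case 0
      then show ?case by (simp add: seq.independent_empty)
    next
      case (Suc m)
      have im: "?g ` {..<Suc m} = insert (?g m) (?g ` {..<m})"
        by (simp only: lessThan_Suc image_insert)
      have notin: "?g m \<notin> ?g ` {..<m}" using new[of m] by (rule contra_subsetD[OF seq.span_superset])
      have "seq.independent (insert (?g m) (?g ` {..<m}))"
        using seq.independent_insertI[OF new[of m]] Suc.IH by blast
      moreover have "card (insert (?g m) (?g ` {..<m})) = Suc m"
        using card_insert_disjoint[OF _ notin] Suc.IH by (metis finite_imageI finite_lessThan)
      ultimately show ?case unfolding im by blast
    qed
    then have ind: "seq.independent (?g ` {..<Suc (card B)})"
      and card: "card (?g ` {..<Suc (card B)}) = Suc (card B)" by blast+
    have "?g ` {..<Suc (card B)} \<subseteq> seq.span B" using sp by blast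
    from seq.independent_span_bound[OF fin ind this] show False unfolding card by simp
  qed
  then obtain m c where c: "\<And>n. f (n + m) = (\<Sum>i<m. c i * f (n + i))"
    using seq_span_image_lessThan[where g = ?g] by blast
  show ?thesis
  proof (cases "m = 0")
    case True
    \<comment> \<open>An empty recursion means \<open>f = 0\<close>; the order must be positive, so use order \<open>1\<close>.\<close>
    then have "f n = 0" for n using c by simp
    then show ?thesis unfolding eventually_linearly_recursive_def
      by (intro exI[of _ 1]) auto
  next
    case False
    then show ?thesis unfolding eventually_linearly_recursive_def
      using c by (intro exI[of _ m] conjI exI[of _ c] always_eventually allI) auto
  qed
qed

section \<open>The pairing as a functional on a quotient algebra\<close>

text \<open>A summation range independent of the degree makes the pairing visibly linear.\<close>
lemma poly_pairing_eq_sum: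
  assumes "degree p \<le> n"
  shows "p \<triangleright> a = (\<Sum>k\<le>n. coeff p k * a k)"
  unfolding poly_pairing_def
  by (rule sum.mono_neutral_left) (use assms in \<open>auto simp: coeff_eq_0\<close>)

lemma poly_pairing_0 [simp]: "0 \<triangleright> a = 0"
  by (simp add: poly_pairing_def)

lemma poly_pairing_add: "(p + q) \<triangleright> a = p \<triangleright> a + q \<triangleright> a"
proof -
  let ?n = "max (degree p) (degree q)"
  have "degree (p + q) \<le> ?n" by (rule degree_add_le_max)
  then show ?thesis
    by (simp add: poly_pairing_eq_sum[of _ ?n] sum.distrib distrib_right)
qed

lemma poly_pairing_smult: "smult c p \<triangleright> a = c * (p \<triangleright> a)"
  using degree_smult_le[of c p]
  by (simp add: poly_pairing_eq_sum[of _ "degree p"] sum_distrib_left mult.assoc)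

lemma poly_pairing_diff: "(p - q) \<triangleright> a = p \<triangleright> a - q \<triangleright> a"
  using poly_pairing_add[of "p - q" q a] by simp

lemma poly_pairing_sum: "(\<Sum>i\<in>A. p i) \<triangleright> a = (\<Sum>i\<in>A. p i \<triangleright> a)"
  by (induction A rule: infinite_finite_induct) (auto simp: poly_pairing_add)

lemma poly_pairing_monom: "monom c k \<triangleright> a = c * a k"
  by (simp add: poly_pairing_eq_sum[of _ k] degree_monom_le if_distrib[of "\<lambda>x. x * _"] cong: if_cong)

text \<open>
  If the recursion holds from index \<open>N\<close> on and has characteristic polynomial \<open>\<chi>\<close>, then
  pairing \<open>x\<^sup>N \<chi> x\<^sup>k\<close> with \<open>a\<close> evaluates the recursion at index \<open>N + k\<close>, so
  \<open>x\<^sup>N \<chi>\<close> is an annihilator.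
\<close>
lemma poly_pairing_annihilator:
  fixes a :: "nat \<Rightarrow> 'a::comm_ring_1"
  assumes "eventually_linearly_recursive a"
  obtains M where "M \<noteq> 0" "\<And>p. (M * p) \<triangleright> a = 0"
proof -
  from assms obtain T c N
    where rec: "\<And>n. n \<ge> N \<Longrightarrow> a (n + T) = (\<Sum>i<T. c i * a (n + i))"
    unfolding eventually_linearly_recursive_def eventually_sequentially by blast
  define M where "M = monom 1 (N + T) - (\<Sum>i<T. monom (c i) (N + i))"
  have "coeff M (N + T) = 1" by (simp add: M_def coeff_sum)
  then have "M \<noteq> 0" by auto
  have mon: "(M * monom b k) \<triangleright> a = 0" for b k
  proof -
    have "(M * monom b k) \<triangleright> a = b * (a (N + k + T) - (\<Sum>i<T. c i * a (N + k + i)))"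
      by (simp add: M_def left_diff_distrib sum_distrib_right mult_monom poly_pairing_diff
          poly_pairing_sum poly_pairing_monom right_diff_distrib sum_distrib_left ac_simps)
    then show ?thesis using rec[of "N + k"] by simp
  qed
  have "(M * p) \<triangleright> a = 0" for p
  proof -
    have "M * p = (\<Sum>k\<le>degree p. M * monom (coeff p k) k)"
      by (simp add: poly_as_sum_of_monoms flip: sum_distrib_left)
    then show ?thesis by (simp add: poly_pairing_sum mon)
  qed
  with \<open>M \<noteq> 0\<close> show ?thesis by (rule that)
qed

section \<open>Recursive sequences of polynomials\<close>

text \<open>
  The polynomial multiplier \<open>q\<close> is what makes the induction on the shift \<open>s\<close> work: the
  recursion for \<open>R\<close> trades a large shift for smaller ones at the price of multiplying by its
  coefficients, and a multiplier of any size can be reduced modulo \<open>M\<close> once the shift is small.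
\<close>
lemma module_shifts_in_span:
  fixes R :: "nat \<Rightarrow> 'k::field poly"
  assumes M: "M \<noteq> 0" "\<And>p. (M * p) \<triangleright> a = 0"
    and rec: "\<And>n. R (n + L) = (\<Sum>i<L. C i * R (n + i))"
  shows "(\<lambda>n. (q * R (n + s)) \<triangleright> a) \<in>
    seq.span ((\<lambda>(j, i) n. (monom 1 j * R (n + i)) \<triangleright> a) ` ({..degree M} \<times> {..<L}))"
    (is "_ \<in> seq.span ?G")
proof (induction s arbitrary: q rule: less_induct)
  case (less s)
  show ?case
  proof (cases "s < L")
    case True
    define r where "r = q mod M"
    have deg: "degree r \<le> degree M"
      using degree_mod_less'[OF M(1), of q] by (cases "r = 0") (auto simp: r_def)
    have "(q * R (n + s)) \<triangleright> a = (\<Sum>j\<le>degree r. coeff r j * ((monom 1 j * R (n + s)) \<triangleright> a))" for n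
    proof -
      have "q * R (n + s) = M * (q div M * R (n + s)) + r * R (n + s)"
        by (metis r_def mult_div_mod_eq distrib_right mult.assoc)
      then have "(q * R (n + s)) \<triangleright> a = (r * R (n + s)) \<triangleright> a"
        by (simp add: poly_pairing_add M(2))
      also have "r * R (n + s) = (\<Sum>j\<le>degree r. monom (coeff r j) j) * R (n + s)"
        by (simp add: poly_as_sum_of_monoms)
      also have "\<dots> = (\<Sum>j\<le>degree r. smult (coeff r j) (monom 1 j * R (n + s)))"
        by (simp add: sum_distrib_right smult_monom flip: mult_smult_left)
      finally show ?thesis by (simp add: poly_pairing_sum poly_pairing_smult)
    qed
    then have "(\<lambda>n. (q * R (n + s)) \<triangleright> a) =
        (\<Sum>j\<le>degree r. (\<lambda>n. coeff r j * ((monom 1 j * R (n + s)) \<triangleright> a)))"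
      by (simp add: fun_eq_iff sum_fun_apply)
    also have "\<dots> \<in> seq.span ?G"
    proof (rule seq.span_sum)
      fix j assume "j \<in> {..degree r}"
      then have "(\<lambda>n. (monom 1 j * R (n + s)) \<triangleright> a) \<in> ?G"
        using deg True by (intro image_eqI[of _ _ "(j, s)"]) auto
      then show "(\<lambda>n. coeff r j * ((monom 1 j * R (n + s)) \<triangleright> a)) \<in> seq.span ?G"
        by (intro seq.span_scale seq.span_base)
    qed
    finally show ?thesis .
  next
    case False
    define t where "t = s - L"
    have s: "s = t + L" using False by (simp add: t_def)
    have "(q * R (n + s)) \<triangleright> a = (\<Sum>i<L. ((q * C i) * R (n + (t + i))) \<triangleright> a)" for n
      using rec[of "n + t"]
      by (simp add: s add.assoc sum_distrib_left poly_pairing_sum mult.assoc)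
    then have "(\<lambda>n. (q * R (n + s)) \<triangleright> a) = (\<Sum>i<L. (\<lambda>n. ((q * C i) * R (n + (t + i))) \<triangleright> a))"
      by (simp add: fun_eq_iff sum_fun_apply)
    also have "\<dots> \<in> seq.span ?G"
      by (intro seq.span_sum less.IH) (simp add: s)
    finally show ?thesis .
  qed
qed

theorem proposition1p15:
  fixes P :: "nat \<Rightarrow> 'k::field poly"
  assumes "eventually_linearly_recursive P"
  shows "recursively_well_adjusted P"
  unfolding recursively_well_adjusted_def
proof (intro allI impI)
  fix a :: "nat \<Rightarrow> 'k"
  assume "eventually_linearly_recursive a"
  from poly_pairing_annihilator[OF this]
  obtain M where M: "M \<noteq> 0" "\<And>p. (M * p) \<triangleright> a = 0" by blast
  from assms obtain L C N
    where rec: "\<And>n. n \<ge> N \<Longrightarrow> P (n + L) = (\<Sum>i<L. C i * P (n + i))"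
    unfolding eventually_linearly_recursive_def eventually_sequentially by blast
  define R where "R n = P (n + N)" for n
  have "R (n + L) = (\<Sum>i<L. C i * R (n + i))" for n
    using rec[of "n + N"] by (simp add: R_def ac_simps)
  from module_shifts_in_span[OF M this, where q = 1]
  have "(\<lambda>n. R (n + s) \<triangleright> a) \<in>
      seq.span ((\<lambda>(j, i) n. (monom 1 j * R (n + i)) \<triangleright> a) ` ({..degree M} \<times> {..<L}))" for s
    by simp
  then have "eventually_linearly_recursive (\<lambda>n. R n \<triangleright> a)"
    by (rule eventually_linearly_recursive_if_shifts_finite_dim[rotated]) simp
  then show "eventually_linearly_recursive (\<lambda>n. P n \<triangleright> a)"
    unfolding R_def by (rule eventually_linearly_recursive_shiftD)
qed

end
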